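(* Let $(\bar\alpha^*,\bar\beta^*,\gamma^* )$ be an optimal solution of the convex program $$\begin{aligned} \max_{\bar\alpha,\bar\beta,\gamma}\ & -\sum_{k=1}^K\log\Big[1+\exp\Big(\sum_{j=1}^N -Z_kp^k_j\bar\alpha_j\Big)\Big]\\ \text{s.t. } & \bar\beta_j=(\bar\alpha_{j+1}-\bar\alpha_j)/(y_{j+1}-y_j),\ j=1,\dots,N-1,\\ & \bar\beta_{j+1}\le\bar\beta_j,\ j=1,\dots,N-2,\\ & \bar\beta_1\le L\gamma,\ \bar\beta_{N-1}\ge 0,\\ & \bar\alpha_1=0,\ \bar\alpha_N=\gamma,\\ & \bar\alpha\in\mathbb{R}^N,\ \bar\beta\in\mathbb{R}^{N-1},\ \gamma\in[0,\bar c]. \end{aligned}$$ If $\gamma^*=0$, then (with the implied scale parameter $\hat\sigma_{\rm MLE}=1/\gamma^*$ read as $+\infty$) there exists no $u\in\mathcal{U}_c$ that rationalizes the data, i.e. no $u\in\mathcal{U}_c$ with $\sum_{k=1}^K Z_k\big(\mathbb{E}[u(W_k)]-\mathbb{E}[u(Y_k)]\big)>0$. If $\gamma^*>0$, define $\hat\alpha^{\rm MLE}:=\bar\alpha^*/\gamma^*$, $\hat\beta^{\rm MLE}:=\bar\beta^*/\gamma^*$, $\hat\sigma_{\rm MLE}:=1/\gamma^*$ and the piecewise linear function $$\hat u_{\rm MLE}(y)=\begin{cases}0 & y=y_1=0,\\ \hat\beta^{\rm MLE}_j(y-y_j)+\hat\alpha^{\rm MLE}_j & y_j\le y<y_{j+1},\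 j=1,\dots,N-1,\\ 1 & y=y_N=\bar b.\end{cases}$$ Then $(\hat u_{\rm MLE},\hat\sigma_{\rm MLE})\in\arg\max_{u\in\mathcal{U}_c,\ \sigma\ge 1/\bar c}\ \ell(u,\sigma)$, and the optimal value of $\max_{u\in\mathcal{U}_c,\ \sigma\ge1/\bar c}\ell(u,\sigma)$ coincides with the optimal value of the convex program above.
   Context: Fix constants $\bar b>0$, $L>0$, $\bar c>0$. $\mathcal{U}_c$ is the set of all functions $u:[0,\bar b]\to\mathbb{R}$ that are monotonically increasing (in the weak sense, i.e. nondecreasing), concave, Lipschitz continuous with modulus at most $L$, and satisfy $u(0)=0$, $u(\bar b)=1$. It is a standing assumption that $\mathcal{U}_c$ is nonempty. A dataset $D=\{(W_k,Y_k,Z_k): k=1,\dots,K\}$ is given, where $W_k,Y_k$ are random variables (lotteries) with finite support contained in $[0,\bar b]$ and $Z_k\in\{1,-1\}$ ($Z_k=1$ means $W_k$ was chosen over $Y_k$). Let $\mathbb{Y}=\{y_1<\dots<y_N\}$ be the ordered list of all points of $\{0,\bar b\}\cup\bigcup_k \mathrm{supp}(W_k)\cup\bigcup_k\mathrm{supp}(Y_k)$, so $y_1=0$, $y_N=\bar b$. Put $p^k_j=\mathbb{P}[W_k=y_j]-\mathbb{P}[Y_k=y_j]$. The log-likelihood, for $u\in\mathcal{U}_c$ and real $\sigma\ge 1/\bar c$, is $$\ell(u,\sigma)=-\sum_{k=1}^K\log\Big[1+\exp\Big(\frac{\sum_{j=1}^N -Z_kp^k_j\,u(y_j)}{\sigma}\Big)\Big].$$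 *)

theory Defs
  imports "HOL-Probability.Probability"
begin

(* Functions on [0,b] are total functions constrained on {0..b} only; nothing below depends on
   their values elsewhere. *)
definition utilities :: "real \<Rightarrow> real \<Rightarrow> (real \<Rightarrow> real) set" where
  "utilities b L = {u. mono_on {0..b} u \<and> concave_on {0..b} u \<and> L-lipschitz_on {0..b} u \<and>
                       u 0 = 0 \<and> u b = 1}"

(* A data set of size K consists of W, Y, Z at the indices 1..K; a lottery is given by its law. *)
definition is_dataset ::
  "real \<Rightarrow> nat \<Rightarrow> (nat \<Rightarrow> real pmf) \<Rightarrow> (nat \<Rightarrow> real pmf) \<Rightarrow> (nat \<Rightarrow> real) \<Rightarrow> bool" where
  "is_dataset b K W Y Z \<longleftrightarrow> (\<forall>k\<in>{1..K}.
     finite (set_pmf (W k)) \<and> set_pmf (W k) \<subseteq> {0..b} \<and>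
     finite (set_pmf (Y k)) \<and> set_pmf (Y k) \<subseteq> {0..b} \<and>
     Z k \<in> {1, -1})"

definition outcomes :: "real \<Rightarrow> nat \<Rightarrow> (nat \<Rightarrow> real pmf) \<Rightarrow> (nat \<Rightarrow> real pmf) \<Rightarrow> real set" where
  "outcomes b K W Y =
     {0, b} \<union> (\<Union>k\<in>{1..K}. set_pmf (W k)) \<union> (\<Union>k\<in>{1..K}. set_pmf (Y k))"

definition num_outcomes :: "real \<Rightarrow> nat \<Rightarrow> (nat \<Rightarrow> real pmf) \<Rightarrow> (nat \<Rightarrow> real pmf) \<Rightarrow> nat" where
  "num_outcomes b K W Y = card (outcomes b K W Y)"

(* 1-based: the outcomes are y_1 < ... < y_N; the value is meaningful only for j in {1..N}. *)
definition outcome ::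
  "real \<Rightarrow> nat \<Rightarrow> (nat \<Rightarrow> real pmf) \<Rightarrow> (nat \<Rightarrow> real pmf) \<Rightarrow> nat \<Rightarrow> real" where
  "outcome b K W Y j = sorted_list_of_set (outcomes b K W Y) ! (j - 1)"

definition prob_diff ::
  "real \<Rightarrow> nat \<Rightarrow> (nat \<Rightarrow> real pmf) \<Rightarrow> (nat \<Rightarrow> real pmf) \<Rightarrow> nat \<Rightarrow> nat \<Rightarrow> real" where
  "prob_diff b K W Y k j = pmf (W k) (outcome b K W Y j) - pmf (Y k) (outcome b K W Y j)"

definition log_likelihood ::
  "real \<Rightarrow> nat \<Rightarrow> (nat \<Rightarrow> real pmf) \<Rightarrow> (nat \<Rightarrow> real pmf) \<Rightarrow> (nat \<Rightarrow> real) \<Rightarrow>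
   (real \<Rightarrow> real) \<Rightarrow> real \<Rightarrow> real" where
  "log_likelihood b K W Y Z u \<sigma> =
     - (\<Sum>k=1..K. ln (1 + exp ((\<Sum>j=1..num_outcomes b K W Y.
           - Z k * prob_diff b K W Y k j * u (outcome b K W Y j)) / \<sigma>)))"

definition rationalizes ::
  "nat \<Rightarrow> (nat \<Rightarrow> real pmf) \<Rightarrow> (nat \<Rightarrow> real pmf) \<Rightarrow> (nat \<Rightarrow> real) \<Rightarrow> (real \<Rightarrow> real) \<Rightarrow> bool" where
  "rationalizes K W Y Z u \<longleftrightarrow>
     (\<Sum>k=1..K. Z k * (measure_pmf.expectation (W k) u - measure_pmf.expectation (Y k) u)) > 0"

(* Vectors in R^N and R^(N-1) are functions on nat of which only the coordinates in {1..N}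
   and {1..N-1} are constrained or used. *)
definition program_feasible ::
  "real \<Rightarrow> real \<Rightarrow> real \<Rightarrow> nat \<Rightarrow> (nat \<Rightarrow> real pmf) \<Rightarrow> (nat \<Rightarrow> real pmf) \<Rightarrow>
   ((nat \<Rightarrow> real) \<times> (nat \<Rightarrow> real) \<times> real) set" where
  "program_feasible b L c K W Y = {(\<alpha>, \<beta>, \<gamma>).
     let N = num_outcomes b K W Y; y = outcome b K W Y in
       (\<forall>j\<in>{1..N - 1}. \<beta> j = (\<alpha> (j + 1) - \<alpha> j) / (y (j + 1) - y j)) \<and>
       (\<forall>j\<in>{1..N - 2}. \<beta> (j + 1) \<le> \<beta> j) \<and>
       \<beta> 1 \<le> L * \<gamma> \<and> \<beta> (N - 1) \<ge> 0 \<and>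
       \<alpha> 1 = 0 \<and> \<alpha> N = \<gamma> \<and>
       \<gamma> \<in> {0..c}}"

definition program_objective ::
  "real \<Rightarrow> nat \<Rightarrow> (nat \<Rightarrow> real pmf) \<Rightarrow> (nat \<Rightarrow> real pmf) \<Rightarrow> (nat \<Rightarrow> real) \<Rightarrow>
   (nat \<Rightarrow> real) \<times> (nat \<Rightarrow> real) \<times> real \<Rightarrow> real" where
  "program_objective b K W Y Z = (\<lambda>(\<alpha>, \<beta>, \<gamma>).
     - (\<Sum>k=1..K. ln (1 + exp (\<Sum>j=1..num_outcomes b K W Y.
           - Z k * prob_diff b K W Y k j * \<alpha> j))))"

(* Piecewise linear function with slopes \<beta> j and node values \<alpha> j. For x strictly between
   y_1 and y_N the index j is unique; outside [y_1, y_N] the value is unspecified. *)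
definition piecewise_linear ::
  "nat \<Rightarrow> (nat \<Rightarrow> real) \<Rightarrow> (nat \<Rightarrow> real) \<Rightarrow> (nat \<Rightarrow> real) \<Rightarrow> real \<Rightarrow> real" where
  "piecewise_linear N y \<alpha> \<beta> x =
     (if x = y 1 then 0
      else if x = y N then 1
      else let j = (THE j. j \<in> {1..N - 1} \<and> y j \<le> x \<and> x < y (j + 1))
           in \<beta> j * (x - y j) + \<alpha> j)"

end

theory Submission
  imports Defs
begin

text \<open>
  Substituting \<open>\<alpha> = u / \<sigma>\<close> on the grid and \<open>\<gamma> = 1 / \<sigma>\<close> turns the likelihood into the objective of
  the program, and the constraints on \<open>u\<close> into those of the program. In the other direction, a
  feasible point with \<open>\<gamma> > 0\<close> is interpolated; the interpolant is the lower envelope of its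
  finitely many affine pieces, so it inherits concavity, monotonicity and the Lipschitz bound from
  them. The case \<open>\<gamma> = 0\<close> forces \<open>\<alpha> = 0\<close>; a utility that rationalizes the data would then give an
  ascent direction at the optimum.
\<close>

section \<open>Concavity on the real line: slopes and lower envelopes of affine functions\<close>

lemma concave_on_slope_decreasing:
  fixes u :: "real \<Rightarrow> real"
  assumes u: "concave_on S u" and S: "x \<in> S" "z \<in> S" and less: "x < y" "y < z"
  shows "(u z - u y) / (z - y) \<le> (u y - u x) / (y - x)"
proof -
  \<comment> \<open>The weight that makes \<open>y\<close> the convex combination of
    \<open>x\<close> and \<open>z\<close>; concavity is then multiplied by \<open>z - x\<close> to
    clear the denominator.\<close>
  define t where "t = (y - x) / (z - x)"
  have t: "0 \<le> t" "t \<le> 1"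
    using less by (auto simp: t_def field_simps)
  have tz: "t * (z - x) = y - x"
    using less by (simp add: t_def)
  then have z: "(1 - t) * x + t * z = y"
    by (simp add: algebra_simps)
  have "(1 - t) * u x + t * u z \<le> u y"
    using concave_onD[OF u t S] by (simp add: z)
  then have "(z - x) * ((1 - t) * u x + t * u z) \<le> (z - x) * u y"
    using less by (intro mult_left_mono) auto
  moreover have "(z - x) * ((1 - t) * u x + t * u z) = (z - x) * u x + t * (z - x) * (u z - u x)"
    by (simp add: algebra_simps)
  ultimately have "(u z - u y) * (y - x) \<le> (u y - u x) * (z - y)"
    unfolding tz by (simp add: algebra_simps)
  then show ?thesis
    using less by (simp add: field_simps)
qed

text \<open>Each property is tested with one piece: it agrees with \<open>u\<close> at the point
  where it is active and lies above \<open>u\<close> elsewhere in \<open>S\<close>, so its own slope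
  controls \<open>u\<close>.\<close>

lemma lower_envelope:
  fixes u :: "real \<Rightarrow> real" and l :: "'i \<Rightarrow> real \<Rightarrow> real" and \<beta> :: "'i \<Rightarrow> real"
  assumes "convex S"
    and env: "\<And>x. x \<in> S \<Longrightarrow> \<exists>i\<in>I. u x = l i x \<and> (\<forall>j\<in>I. l i x \<le> l j x)"
    and l: "\<And>i x y. i \<in> I \<Longrightarrow> l i y - l i x = \<beta> i * (y - x)"
    and \<beta>: "\<And>i. i \<in> I \<Longrightarrow> 0 \<le> \<beta> i" "\<And>i. i \<in> I \<Longrightarrow> \<beta> i \<le> L"
    and "0 \<le> L"
  shows "mono_on S u" "concave_on S u" "L-lipschitz_on S u"
proof -
  have below: "u x \<le> l i x" if "x \<in> S" "i \<in> I" for x i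
    using env[OF that(1)] that(2) by auto
  show mono: "mono_on S u"
  proof (rule mono_onI)
    fix x y assume "x \<in> S" "y \<in> S" "x \<le> y"
    \<comment> \<open>The piece active at the larger point gives
      \<open>u x \<le> l i x \<le> l i y = u y\<close>.\<close>
    then obtain i where i: "i \<in> I" "u y = l i y"
      using env by blast
    have "0 \<le> \<beta> i * (y - x)"
      using \<beta>(1)[OF i(1)] \<open>x \<le> y\<close> by simp
    then show "u x \<le> u y"
      using below[OF \<open>x \<in> S\<close> i(1)] l[OF i(1), of y x] i(2) by linarith
  qed
  show "concave_on S u"
    unfolding concave_on_iff
  proof (intro conjI ballI allI impI)
    fix x y p q :: real
    assume *: "x \<in> S" "y \<in> S" "0 \<le> p" "0 \<le> q" "p + q = 1"
    let ?z = "p *\<^sub>R x + q *\<^sub>R y"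
    have "?z \<in> S"
      using convexD[OF \<open>convex S\<close>] * by blast
    then obtain i where i: "i \<in> I" "u ?z = l i ?z"
      using env by blast
    have q: "q = 1 - p" using * by simp
    have "p * u x + q * u y \<le> p * l i x + q * l i y"
      using * below i(1) by (intro add_mono mult_left_mono) auto
    \<comment> \<open>The weighted deviations from \<open>?z\<close> cancel because the piece is
      affine.\<close>
    also have "\<dots> = l i ?z + (p * (l i x - l i ?z) + q * (l i y - l i ?z))"
      by (simp add: q algebra_simps)
    also have "\<dots> = l i ?z"
      by (simp add: l[OF i(1)]) (simp add: q algebra_simps)
    finally show "p * u x + q * u y \<le> u ?z"
      using i(2) by simp
  qed fact
  have le: "\<bar>u x - u y\<bar> \<le> L * \<bar>x - y\<bar>" if xy: "x \<in> S" "y \<in> S" "x \<le> y" for x y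
  proof -
    \<comment> \<open>Here the piece active at the smaller point is taken, since it bounds the
      growth of \<open>u\<close> up to \<open>y\<close>.\<close>
    obtain i where i: "i \<in> I" "u x = l i x"
      using env xy(1) by blast
    have "\<beta> i * (y - x) \<le> L * (y - x)"
      using \<beta>(2)[OF i(1)] xy(3) by (simp add: mult_right_mono)
    moreover have "u x \<le> u y"
      using mono_onD[OF mono xy] .
    ultimately show ?thesis
      using below[OF xy(2) i(1)] l[OF i(1), of y x] i(2) xy(3) by simp
  qed
  show "L-lipschitz_on S u"
  proof (rule lipschitz_onI)
    fix x y assume "x \<in> S" "y \<in> S"
    then show "dist (u x) (u y) \<le> L * dist x y"
      using le[of x y] le[of y x] by (cases "x \<le> y") (auto simp: dist_real_def abs_minus_commute)
  qed fact
qed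

section \<open>Interpolation on a grid\<close>

text \<open>The constraints that survive division by a positive \<open>\<gamma>\<close>; hence both
  a feasible point and its rescaling are instances.\<close>

locale concave_grid =
  fixes N :: nat and y \<alpha> \<beta> :: "nat \<Rightarrow> real"
  assumes N: "2 \<le> N"
    and grid_less: "\<And>i j. 1 \<le> i \<Longrightarrow> i < j \<Longrightarrow> j \<le> N \<Longrightarrow> y i < y j"
    and slope: "\<And>j. j \<in> {1..N - 1} \<Longrightarrow> \<beta> j = (\<alpha> (j + 1) - \<alpha> j) / (y (j + 1) - y j)"
    and slope_Suc: "\<And>j. j \<in> {1..N - 2} \<Longrightarrow> \<beta> (j + 1) \<le> \<beta> j"
    and slope_last: "0 \<le> \<beta> (N - 1)"
    and first_value: "\<alpha> 1 = 0"
begin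

lemma grid_le: "1 \<le> i \<Longrightarrow> i \<le> j \<Longrightarrow> j \<le> N \<Longrightarrow> y i \<le> y j"
  using grid_less[of i j] by (cases "i = j") auto

lemma value_Suc: "j \<in> {1..N - 1} \<Longrightarrow> \<alpha> (j + 1) = \<alpha> j + \<beta> j * (y (j + 1) - y j)"
  using slope[of j] grid_less[of j "j + 1"] N by force

lemma slope_antimono:
  assumes "1 \<le> i" "i \<le> j" "j \<le> N - 1" shows "\<beta> j \<le> \<beta> i"
  using assms(2,3)
proof (induction j rule: dec_induct)
  case (step j)
  then show ?case using slope_Suc[of j] assms(1) by force
qed simp

lemma slope_nonneg: "j \<in> {1..N - 1} \<Longrightarrow> 0 \<le> \<beta> j"
  using slope_antimono[of j "N - 1"] slope_last by force

text \<open>The slopes are squeezed between a nonnegative last one and a nonpositive first one. This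
  is the situation at \<open>\<gamma> = 0\<close>.\<close>

lemma values_eq_0:
  assumes "\<beta> 1 \<le> 0" "1 \<le> j" "j \<le> N" shows "\<alpha> j = 0"
  using assms(2,3)
proof (induction j rule: dec_induct)
  case (step j)
  then have j: "j \<in> {1..N - 1}" by auto
  have "\<beta> j = 0"
    using slope_nonneg[OF j] slope_antimono[of 1 j] assms(1) j by force
  then show ?case using value_Suc[OF j] step by simp
qed (use first_value in simp)

text \<open>The affine extension to the whole line, so that pieces can be compared outside their own
  intervals.\<close>

definition piece :: "nat \<Rightarrow> real \<Rightarrow> real" where
  "piece j x = \<beta> j * (x - y j) + \<alpha> j"

text \<open>Neighbouring lines cross at their common node, so the sign of their difference depends
  only on the side of that node.\<close>

lemma piece_Suc:
  "j \<in> {1..N - 2} \<Longrightarrow> piece (j + 1) x - piece j x = (\<beta> (j + 1) - \<beta> j) * (x - y (j + 1))"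
  using value_Suc[of j] by (force simp: piece_def algebra_simps)

text \<open>All crossings between piece \<open>i\<close> and piece \<open>j\<close> lie at or to the
  right of \<open>x\<close>, and left of a crossing the later, flatter line is the higher
  one.\<close>

lemma piece_le_right:
  assumes "1 \<le> i" "i \<le> j" "j \<le> N - 1" "x \<le> y (i + 1)" shows "piece i x \<le> piece j x"
  using assms(2,3)
proof (induction j rule: dec_induct)
  case (step j)
  then have j: "j \<in> {1..N - 2}" using assms(1) by auto
  have "x \<le> y (j + 1)"
    using grid_le[of "i + 1" "j + 1"] step assms j by force
  then have "0 \<le> (\<beta> (j + 1) - \<beta> j) * (x - y (j + 1))"
    using slope_Suc[OF j] by (intro mult_nonpos_nonpos) auto
  then show ?case using piece_Suc[OF j, of x] step by simp
qed simp

text \<open>The mirror image: all crossings lie at or to the left of \<open>x\<close>, and the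
  induction runs downwards from \<open>i\<close>.\<close>

lemma piece_le_left:
  assumes "1 \<le> j" "j \<le> i" "i \<le> N - 1" "y i \<le> x" shows "piece i x \<le> piece j x"
  using assms(2,1)
proof (induction j rule: inc_induct)
  case (step j)
  then have j: "j \<in> {1..N - 2}" using assms(3) by auto
  have "y (j + 1) \<le> x"
    using grid_le[of "j + 1" i] step assms j by force
  then have "(\<beta> (j + 1) - \<beta> j) * (x - y (j + 1)) \<le> 0"
    using slope_Suc[OF j] by (intro mult_nonpos_nonneg) auto
  then show ?case using piece_Suc[OF j, of x] step by simp
qed simp

lemma interval_exists:
  assumes "y 1 \<le> x" "x < y N"
  shows "\<exists>j\<in>{1..N - 1}. y j \<le> x \<and> x < y (j + 1)"
proof -
  let ?P = "\<lambda>j. 1 \<le> j \<and> j \<le> N \<and> x < y j"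
  \<comment> \<open>The first node strictly to the right of \<open>x\<close>; the interval sought
    ends there.\<close>
  define m where "m = (LEAST j. ?P j)"
  have "?P N" using assms N by simp
  then have m: "?P m" and least: "\<And>j. ?P j \<Longrightarrow> m \<le> j"
    unfolding m_def using LeastI[of ?P] Least_le[of ?P] by blast+
  have "m \<noteq> 1" using m assms(1) by auto
  then have "m - 1 \<in> {1..N - 1}" "m - 1 + 1 = m" using m by auto
  moreover have "y (m - 1) \<le> x"
    using least[of "m - 1"] \<open>m - 1 \<in> {1..N - 1}\<close> m by force
  ultimately show ?thesis using m by metis
qed

lemma piecewise_linear_eq_piece:
  assumes j: "j \<in> {1..N - 1}" and x: "y j \<le> x" "x < y (j + 1)"
  shows "piecewise_linear N y \<alpha> \<beta> x = piece j x"
proof (cases "x = y 1")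
  case True
  then have "j = 1" using grid_less[of 1 j] j x by force
  then show ?thesis using True first_value by (simp add: piecewise_linear_def piece_def)
next
  case False
  \<comment> \<open>The half-open intervals are disjoint, which resolves the definite description in
    \<open>piecewise_linear\<close>.\<close>
  have unique: "i = j" if "i \<in> {1..N - 1}" "y i \<le> x" "x < y (i + 1)" for i
  proof (rule linorder_cases[of i j])
    assume "i < j"
    then show ?thesis using grid_le[of "i + 1" j] that j x by force
  next
    assume "j < i"
    then show ?thesis using grid_le[of "j + 1" i] that j x by force
  qed
  have "x \<noteq> y N" using grid_le[of "j + 1" N] j x by force
  moreover have "(THE i. i \<in> {1..N - 1} \<and> y i \<le> x \<and> x < y (i + 1)) = j"
    using assms unique by (intro the_equality) blast+
  ultimately show ?thesis
    using False by (simp add: piecewise_linear_def piece_def Let_def)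
qed

text \<open>The value 1 hard-wired into \<open>piecewise_linear\<close> at the last node fits the
  node values under this normalization.\<close>

context
  assumes last_value: "\<alpha> N = 1"
begin

lemma piecewise_linear_last: "piecewise_linear N y \<alpha> \<beta> (y N) = 1"
  using grid_less[of 1 N] N by (simp add: piecewise_linear_def)

lemma piecewise_linear_grid:
  assumes "j \<in> {1..N}" shows "piecewise_linear N y \<alpha> \<beta> (y j) = \<alpha> j"
proof (cases "j = N")
  case True
  then show ?thesis using piecewise_linear_last last_value by simp
next
  case False
  then show ?thesis
    using piecewise_linear_eq_piece[of j "y j"] grid_less[of j "j + 1"] assms
    by (force simp: piece_def)
qed

text \<open>The piece of an interval containing \<open>x\<close> lies below the later pieces because
  \<open>x \<le> y (i + 1)\<close>, and below the earlier ones because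
  \<open>y i \<le> x\<close>.\<close>

lemma piecewise_linear_lower_envelope:
  assumes "x \<in> {y 1..y N}"
  shows "\<exists>i\<in>{1..N - 1}. piecewise_linear N y \<alpha> \<beta> x = piece i x \<and>
           (\<forall>j\<in>{1..N - 1}. piece i x \<le> piece j x)"
proof -
  obtain i where i: "i \<in> {1..N - 1}" "y i \<le> x" "x \<le> y (i + 1)"
    and eq: "piecewise_linear N y \<alpha> \<beta> x = piece i x"
  \<comment> \<open>No half-open interval contains \<open>y N\<close>; there the last piece is used,
    whose value is \<open>\<alpha> N = 1\<close>.\<close>
  proof (cases "x = y N")
    case True
    have N1: "N - 1 \<in> {1..N - 1}" "N - 1 + 1 = N" using N by auto
    have "piece (N - 1) x = 1"
      using value_Suc[OF N1(1)] N1(2) last_value True by (simp add: piece_def)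
    then show ?thesis
      using that[OF N1(1)] grid_le[of "N - 1" N] N1 True piecewise_linear_last by force
  next
    case False
    then obtain j where "j \<in> {1..N - 1}" "y j \<le> x" "x < y (j + 1)"
      using interval_exists[of x] assms by auto
    then show ?thesis
      using that[of j] piecewise_linear_eq_piece[of j x] by simp
  qed
  have "piece i x \<le> piece j x" if "j \<in> {1..N - 1}" for j
    using piece_le_right[of i j x] piece_le_left[of j i x] i that by (cases "i \<le> j") auto
  then show ?thesis using i(1) eq by blast
qed

lemma piecewise_linear_in_utilities:
  assumes "y 1 = 0" "y N = b" "\<beta> 1 \<le> L"
  shows "piecewise_linear N y \<alpha> \<beta> \<in> utilities b L"
proof -
  let ?u = "piecewise_linear N y \<alpha> \<beta>"
  have le_L: "\<beta> i \<le> L" if "i \<in> {1..N - 1}" for i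
    using slope_antimono[of 1 i] that assms(3) by force
  have "0 \<le> L"
    using le_L[of 1] slope_nonneg[of 1] N by force
  have "?u 0 = 0"
    using assms(1) by (simp add: piecewise_linear_def)
  moreover have "?u b = 1"
    using piecewise_linear_last assms(2) by simp
  moreover have "mono_on {0..b} ?u" "concave_on {0..b} ?u" "L-lipschitz_on {0..b} ?u"
    using lower_envelope[where S="{0..b}" and u="?u" and l=piece and I="{1..N - 1}" and \<beta>=\<beta> and L=L]
      piecewise_linear_lower_envelope slope_nonneg le_L \<open>0 \<le> L\<close> assms(1,2)
    by (auto simp: piece_def algebra_simps)
  ultimately show ?thesis
    by (simp add: utilities_def)
qed

end

end

section \<open>The estimation problem\<close>

locale lottery_data =
  fixes b L c :: real and K :: nat and W Y :: "nat \<Rightarrow> real pmf" and Z :: "nat \<Rightarrow> real"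
  assumes b_pos: "b > 0" and c_pos: "c > 0" and data: "is_dataset b K W Y Z"
begin

abbreviation "N \<equiv> num_outcomes b K W Y"
abbreviation "y \<equiv> outcome b K W Y"

section \<open>The ordered outcomes, and expected utilities as finite sums\<close>

lemma finite_outcomes: "finite (outcomes b K W Y)"
  using data by (auto simp: outcomes_def is_dataset_def)

lemma outcomes_bounds: "outcomes b K W Y \<subseteq> {0..b}"
  using data b_pos by (auto simp: outcomes_def is_dataset_def)

lemma outcome_less: "1 \<le> i \<Longrightarrow> i < j \<Longrightarrow> j \<le> N \<Longrightarrow> y i < y j"
  using sorted_wrt_nth_less[OF strict_sorted_list_of_set, of "i - 1" "j - 1" "outcomes b K W Y"]
  by (simp add: outcome_def num_outcomes_def)

lemma bij_betw_outcome: "bij_betw y {1..N} (outcomes b K W Y)"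
proof -
  \<comment> \<open>Outcomes are counted from 1, list positions from 0.\<close>
  have "bij_betw (\<lambda>j. j - 1) {1..N} {..<N}"
    by (rule bij_betwI[where g=Suc]) auto
  moreover have "bij_betw ((!) (sorted_list_of_set (outcomes b K W Y))) {..<N} (outcomes b K W Y)"
    using finite_outcomes
    by (intro bij_betw_nth) (auto simp: num_outcomes_def)
  ultimately show ?thesis
    using bij_betw_trans by (fastforce simp: outcome_def[abs_def] comp_def)
qed

lemma outcome_in: "j \<in> {1..N} \<Longrightarrow> y j \<in> {0..b}"
  using bij_betw_apply[OF bij_betw_outcome] outcomes_bounds by blast

lemma two_le_num_outcomes: "2 \<le> N"
proof -
  have "card {0, b} \<le> N"
    unfolding num_outcomes_def
    by (rule card_mono[OF finite_outcomes]) (auto simp: outcomes_def)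
  then show ?thesis using b_pos by simp
qed

lemma outcome_le: "1 \<le> i \<Longrightarrow> i \<le> j \<Longrightarrow> j \<le> N \<Longrightarrow> y i \<le> y j"
  using outcome_less[of i j] by (cases "i = j") auto

lemma outcome_first: "y 1 = 0"
proof -
  have "0 \<in> y ` {1..N}"
    using bij_betw_imp_surj_on[OF bij_betw_outcome] by (simp add: outcomes_def)
  then obtain i where "i \<in> {1..N}" "y i = 0" by auto
  then show ?thesis
    using outcome_le[of 1 i] outcome_in[of 1] by force
qed

lemma outcome_last: "y N = b"
proof -
  have "b \<in> y ` {1..N}"
    using bij_betw_imp_surj_on[OF bij_betw_outcome] by (simp add: outcomes_def)
  then obtain i where "i \<in> {1..N}" "y i = b" by auto
  then show ?thesis
    using outcome_le[of i N] outcome_in[of N] by force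
qed

lemma expectation_eq_sum:
  assumes "set_pmf p \<subseteq> outcomes b K W Y"
  shows "measure_pmf.expectation p u = (\<Sum>j=1..N. pmf p (y j) * u (y j))"
proof -
  have "measure_pmf.expectation p u = (\<Sum>x\<in>outcomes b K W Y. pmf p x * u x)"
    using integral_measure_pmf[OF finite_outcomes, of p u] assms by auto
  also have "\<dots> = (\<Sum>j=1..N. pmf p (y j) * u (y j))"
    using sum.reindex_bij_betw[OF bij_betw_outcome, of "\<lambda>x. pmf p x * u x"] by simp
  finally show ?thesis .
qed

text \<open>Links the expectations in \<open>rationalizes\<close> to the indexed sums in the
  likelihood and the program.\<close>

lemma expectation_diff_eq_sum:
  assumes "k \<in> {1..K}"
  shows "measure_pmf.expectation (W k) u - measure_pmf.expectation (Y k) u =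
    (\<Sum>j=1..N. prob_diff b K W Y k j * u (y j))"
proof -
  have "set_pmf (W k) \<subseteq> outcomes b K W Y" "set_pmf (Y k) \<subseteq> outcomes b K W Y"
    using assms by (auto simp: outcomes_def)
  then show ?thesis
    by (simp add: expectation_eq_sum prob_diff_def sum_subtractf left_diff_distrib)
qed

section \<open>Utilities as feasible points of the program\<close>

definition utility_point :: "(real \<Rightarrow> real) \<Rightarrow> real \<Rightarrow> (nat \<Rightarrow> real) \<times> (nat \<Rightarrow> real) \<times> real" where
  "utility_point u \<gamma> =
     (\<lambda>j. \<gamma> * u (y j), \<lambda>j. \<gamma> * ((u (y (j + 1)) - u (y j)) / (y (j + 1) - y j)), \<gamma>)"

text \<open>Concavity orders the slopes, the Lipschitz bound caps the first and monotonicity makes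
  the last nonnegative; scaling by \<open>\<gamma> \<ge> 0\<close> preserves all three. Allowing
  \<open>\<gamma> = 0\<close> makes \<open>utility_point u\<close> a ray starting at the zero
  vector.\<close>

lemma utility_point_feasible:
  assumes u: "u \<in> utilities b L" and \<gamma>: "0 \<le> \<gamma>" "\<gamma> \<le> c"
  shows "utility_point u \<gamma> \<in> program_feasible b L c K W Y"
proof -
  let ?s = "\<lambda>j. (u (y (j + 1)) - u (y j)) / (y (j + 1) - y j)"
  have u': "mono_on {0..b} u" "concave_on {0..b} u" "L-lipschitz_on {0..b} u" "u 0 = 0" "u b = 1"
    using u by (auto simp: utilities_def)
  have N: "2 \<le> N" by (rule two_le_num_outcomes)
  have "?s (j + 1) \<le> ?s j" if "j \<in> {1..N - 2}" for j
    using that outcome_less[of j "j + 1"] outcome_less[of "j + 1" "j + 2"]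
      concave_on_slope_decreasing[OF u'(2), of "y j" "y (j + 2)" "y (j + 1)"]
      outcome_in[of j] outcome_in[of "j + 2"]
    by force
  then have "\<forall>j\<in>{1..N - 2}. \<gamma> * ?s (j + 1) \<le> \<gamma> * ?s j"
    using \<gamma>(1) by (blast intro: mult_left_mono)
  moreover have "?s 1 \<le> L"
  proof -
    have "y 1 < y 2" using outcome_less[of 1 2] N by simp
    then show ?thesis
      using lipschitz_onD[OF u'(3), of "y 2" "y 1"] outcome_in[of 1] outcome_in[of 2] N
      by (simp add: dist_real_def field_simps numeral_2_eq_2)
  qed
  then have "\<gamma> * ?s 1 \<le> L * \<gamma>"
    using mult_left_mono[OF _ \<gamma>(1), of "?s 1" L] by (simp only: mult.commute[of L])
  moreover have "0 \<le> ?s (N - 1)"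
    using mono_onD[OF u'(1), of "y (N - 1)" "y N"] outcome_less[of "N - 1" N]
      outcome_in[of N] outcome_in[of "N - 1"] N
    by force
  then have "0 \<le> \<gamma> * ?s (N - 1)"
    using mult_nonneg_nonneg[OF \<gamma>(1)] by blast
  ultimately show ?thesis
    using \<gamma> u' outcome_first outcome_last
    unfolding utility_point_def program_feasible_def
    by (simp add: Let_def right_diff_distrib)
qed

text \<open>Dividing by \<open>1 / \<gamma>\<close> multiplies by \<open>\<gamma>\<close>; at
  \<open>\<gamma> = 0\<close> this persists because division by zero yields 0.\<close>

lemma program_objective_utility_point:
  "program_objective b K W Y Z (utility_point u \<gamma>) = log_likelihood b K W Y Z u (1 / \<gamma>)"
  by (simp add: program_objective_def utility_point_def log_likelihood_def sum_distrib_left mult_ac)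

section \<open>Optimal points with \<open>\<gamma> = 0\<close> and with
  \<open>\<gamma> > 0\<close>\<close>

lemma concave_grid_feasible:
  assumes "(\<alpha>, \<beta>, \<gamma>) \<in> program_feasible b L c K W Y"
  shows "concave_grid N y \<alpha> \<beta>"
  using assms two_le_num_outcomes outcome_less
  by unfold_locales (auto simp: program_feasible_def Let_def)

lemma not_rationalizes_if_optimal_0:
  assumes opt: "is_arg_max (program_objective b K W Y Z)
      (\<lambda>x. x \<in> program_feasible b L c K W Y) (\<alpha>, \<beta>, 0)"
    and u: "u \<in> utilities b L"
  shows "\<not> rationalizes K W Y Z u"
proof
  assume rat: "rationalizes K W Y Z u"
  have feasible: "(\<alpha>, \<beta>, 0) \<in> program_feasible b L c K W Y"
    using opt by (simp add: is_arg_max_def)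
  interpret concave_grid N y \<alpha> \<beta>
    by (rule concave_grid_feasible[OF feasible])
  have "\<alpha> j = 0" if "j \<in> {1..N}" for j
    using values_eq_0[of j] feasible that by (simp add: program_feasible_def Let_def)
  then have value0: "program_objective b K W Y Z (\<alpha>, \<beta>, 0) =
      program_objective b K W Y Z (utility_point u 0)"
    by (simp add: program_objective_def utility_point_def)
  \<comment> \<open>\<open>d k\<close> is the signed expected utility gap of observation
    \<open>k\<close>, and \<open>- f\<close> is the objective along the ray
    \<open>utility_point u t\<close>.\<close>
  define d where "d k = Z k * (\<Sum>j=1..N. prob_diff b K W Y k j * u (y j))" for k
  define f where "f t = (\<Sum>k=1..K. ln (1 + exp (- t * d k)))" for t
  have objective: "program_objective b K W Y Z (utility_point u t) = - f t" for t
    by (simp add: program_objective_def utility_point_def f_def d_def sum_distrib_left sum_negf mult_ac)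
  have "(\<Sum>k=1..K. d k) > 0"
    using rat by (simp add: rationalizes_def d_def expectation_diff_eq_sum)
  then have "(\<Sum>k=1..K. - d k / 2) < 0"
    by (simp add: sum_negf flip: sum_divide_distrib)
  \<comment> \<open>The factor 1/2 is the logistic weight
    \<open>exp 0 / (1 + exp 0)\<close>.\<close>
  moreover have "(f has_real_derivative (\<Sum>k=1..K. - d k / 2)) (at 0)"
    unfolding f_def[abs_def]
    by (rule DERIV_sum) (auto intro!: derivative_eq_intros simp: add_pos_pos)
  ultimately obtain \<epsilon> where \<epsilon>: "\<epsilon> > 0" "\<And>h. 0 < h \<Longrightarrow> h < \<epsilon> \<Longrightarrow> f h < f 0"
    using DERIV_neg_dec_right[of f _ 0] by auto
  \<comment> \<open>Small enough for the strict decrease of \<open>f\<close>, and at most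
    \<open>c\<close> for feasibility.\<close>
  define h where "h = min (\<epsilon> / 2) c"
  have h: "0 < h" "h < \<epsilon>" "h \<le> c"
    using \<epsilon>(1) c_pos by (auto simp: h_def)
  have "utility_point u h \<in> program_feasible b L c K W Y"
    using utility_point_feasible[OF u] h by simp
  moreover have "program_objective b K W Y Z (\<alpha>, \<beta>, 0) < program_objective b K W Y Z (utility_point u h)"
    using \<epsilon>(2) h value0 objective by simp
  ultimately show False
    using opt unfolding is_arg_max_def by blast
qed

text \<open>The interpolant attains the optimal value of the program, and every admissible
  \<open>(u, \<sigma>)\<close> is bounded by it through
  \<open>utility_point u (1 / \<sigma>)\<close>.\<close>

lemma optimal_pos:
  fixes \<alpha> \<beta> \<gamma>
  defines "u' \<equiv> piecewise_linear N y (\<lambda>j. \<alpha> j / \<gamma>) (\<lambda>j. \<beta> j / \<gamma>)"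
  assumes opt: "is_arg_max (program_objective b K W Y Z)
      (\<lambda>x. x \<in> program_feasible b L c K W Y) (\<alpha>, \<beta>, \<gamma>)"
    and \<gamma>: "\<gamma> > 0"
  shows "u' \<in> utilities b L" "1 / \<gamma> \<ge> 1 / c"
    "log_likelihood b K W Y Z u' (1 / \<gamma>) = program_objective b K W Y Z (\<alpha>, \<beta>, \<gamma>)"
    "\<And>u \<sigma>. u \<in> utilities b L \<Longrightarrow> \<sigma> \<ge> 1 / c \<Longrightarrow>
       log_likelihood b K W Y Z u \<sigma> \<le> program_objective b K W Y Z (\<alpha>, \<beta>, \<gamma>)"
proof -
  have feasible: "(\<alpha>, \<beta>, \<gamma>) \<in> program_feasible b L c K W Y"
    using opt by (simp add: is_arg_max_def)
  then have cons: "\<beta> 1 \<le> L * \<gamma>" "\<alpha> N = \<gamma>" "\<gamma> \<le> c"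
    by (auto simp: program_feasible_def Let_def)
  interpret g: concave_grid N y \<alpha> \<beta>
    by (rule concave_grid_feasible[OF feasible])
  interpret concave_grid N y "\<lambda>j. \<alpha> j / \<gamma>" "\<lambda>j. \<beta> j / \<gamma>"
  proof unfold_locales
    show "0 \<le> \<beta> (N - 1) / \<gamma>"
      using g.slope_last \<gamma> by (intro divide_nonneg_pos)
  qed (use g.N g.grid_less g.slope g.slope_Suc g.first_value \<gamma> in
      \<open>auto simp: divide_right_mono mult.commute simp flip: diff_divide_distrib\<close>)
  have one: "\<alpha> N / \<gamma> = 1" using cons(2) \<gamma> by simp
  show "u' \<in> utilities b L"
    unfolding u'_def using cons(1) \<gamma>
    by (intro piecewise_linear_in_utilities one outcome_first outcome_last)
      (simp add: pos_divide_le_eq)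
  show "1 / \<gamma> \<ge> 1 / c"
    using cons(3) \<gamma> by (simp add: frac_le)
  \<comment> \<open>The likelihood sees a utility only at the nodes, and dividing by
    \<open>1 / \<gamma>\<close> undoes the rescaling.\<close>
  have "u' (y j) = \<alpha> j / \<gamma>" if "j \<in> {1..N}" for j
    unfolding u'_def using piecewise_linear_grid[OF one that] .
  then show "log_likelihood b K W Y Z u' (1 / \<gamma>) = program_objective b K W Y Z (\<alpha>, \<beta>, \<gamma>)"
    using \<gamma> by (simp add: log_likelihood_def program_objective_def sum_distrib_right)
  fix u \<sigma> assume u: "u \<in> utilities b L" and \<sigma>: "\<sigma> \<ge> 1 / c"
  have "0 < \<sigma>" using \<sigma> c_pos by (meson less_le_trans zero_less_divide_1_iff)
  then have "1 / \<sigma> \<le> c" using \<sigma> c_pos by (simp add: field_simps)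
  then have "utility_point u (1 / \<sigma>) \<in> program_feasible b L c K W Y"
    using utility_point_feasible[OF u] \<open>0 < \<sigma>\<close> by simp
  then have "program_objective b K W Y Z (utility_point u (1 / \<sigma>)) \<le>
      program_objective b K W Y Z (\<alpha>, \<beta>, \<gamma>)"
    using opt unfolding is_arg_max_def not_less[symmetric] by blast
  then show "log_likelihood b K W Y Z u \<sigma> \<le> program_objective b K W Y Z (\<alpha>, \<beta>, \<gamma>)"
    by (simp add: program_objective_utility_point)
qed

end

theorem theorem1:
  fixes b L c :: real and K :: nat
    and W Y :: "nat \<Rightarrow> real pmf" and Z :: "nat \<Rightarrow> real"
    and \<alpha> \<beta> :: "nat \<Rightarrow> real" and \<gamma> :: real
  assumes "b > 0" and "L > 0" and "c > 0"
    and "utilities b L \<noteq> {}"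
    and "is_dataset b K W Y Z"
    and "is_arg_max (program_objective b K W Y Z) (\<lambda>x. x \<in> program_feasible b L c K W Y) (\<alpha>, \<beta>, \<gamma>)"
  shows "(\<gamma> = 0 \<longrightarrow> \<not> (\<exists>u\<in>utilities b L. rationalizes K W Y Z u)) \<and>
    (\<gamma> > 0 \<longrightarrow>
      is_arg_max (\<lambda>(u, \<sigma>). log_likelihood b K W Y Z u \<sigma>)
        (\<lambda>(u, \<sigma>). u \<in> utilities b L \<and> \<sigma> \<ge> 1 / c)
        (piecewise_linear (num_outcomes b K W Y) (outcome b K W Y)
           (\<lambda>j. \<alpha> j / \<gamma>) (\<lambda>j. \<beta> j / \<gamma>), 1 / \<gamma>) \<and>
      (SUP (u, \<sigma>)\<in>utilities b L \<times> {1 / c..}. log_likelihood b K W Y Z u \<sigma>) =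
        (SUP x\<in>program_feasible b L c K W Y. program_objective b K W Y Z x))"
proof -
  interpret lottery_data b L c K W Y Z
    by unfold_locales fact+
  let ?u = "piecewise_linear N y (\<lambda>j. \<alpha> j / \<gamma>) (\<lambda>j. \<beta> j / \<gamma>)"
  let ?ll = "log_likelihood b K W Y Z"
  let ?opt = "program_objective b K W Y Z (\<alpha>, \<beta>, \<gamma>)"
  show ?thesis
  proof (intro conjI impI)
    assume "\<gamma> = 0"
    then show "\<not> (\<exists>u\<in>utilities b L. rationalizes K W Y Z u)"
      using not_rationalizes_if_optimal_0 assms(6) by blast
  next
    assume "\<gamma> > 0"
    note max = optimal_pos[OF assms(6) this]
    show "is_arg_max (\<lambda>(u, \<sigma>). ?ll u \<sigma>) (\<lambda>(u, \<sigma>). u \<in> utilities b L \<and> \<sigma> \<ge> 1 / c) (?u, 1 / \<gamma>)"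
      using max by (auto simp: is_arg_max_def not_less)
    \<comment> \<open>Both suprema are attained maxima with value \<open>?opt\<close>, which settles
      nonemptiness and boundedness as well.\<close>
    have "(SUP (u, \<sigma>)\<in>utilities b L \<times> {1 / c..}. ?ll u \<sigma>) = ?opt"
    proof (rule cSup_eq_maximum)
      show "?opt \<in> (\<lambda>(u, \<sigma>). ?ll u \<sigma>) ` (utilities b L \<times> {1 / c..})"
        using max(1,2) by (intro image_eqI[where x="(?u, 1 / \<gamma>)"]) (simp_all add: max(3))
    qed (use max(4) in auto)
    moreover have "(SUP x\<in>program_feasible b L c K W Y. program_objective b K W Y Z x) = ?opt"
      using assms(6) by (intro cSup_eq_maximum) (auto simp: is_arg_max_def not_less)
    ultimately show "(SUP (u, \<sigma>)\<in>utilities b L \<times> {1 / c..}. ?ll u \<sigma>) =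
        (SUP x\<in>program_feasible b L c K W Y. program_objective b K W Y Z x)"
      by simp
  qed
qed

end
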